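(* Let $X$ be a real $n \times p$ matrix with $p < n$ and $\mathrm{rank}(X) = p$, let $\beta \in \mathbb{R}^p$, $\sigma^2>0$, and let $Y$ be a random vector in $\mathbb{R}^n$ with $Y - X\beta \sim N(0, \sigma^2 I_n)$. Let $\hat\beta = (X^T X)^{-1} X^T Y$ and $R = Y - X\hat\beta$. Consider the problem of finding a $p \times p$ matrix $S$ such that for $W = R_{(p)} + X_{(p)} S R^{(p)}$ one has $W \sim N(0, \sigma^2 I_{n-p})$ and $W^T W = R^T R$. If $C$ is a (non-singular) $p \times p$ matrix such that $XC^{-1}$ has orthonormal columns and $C - X^{(p)}$ is non-singular, then $S = \left( C - X^{(p)} \right)^{-1}$ is a solution, and all non-singular solutions $S$ are of this form, for some such $C$.
   Context: For a matrix or column vector $A$ with $n$ rows, $A^{(p)}$ denotes the first $p$ rows of $A$ and $A_{(p)}$ the last $n-p$ rows. $N(m,\Sigma)$ is the multivariate normal distribution with mean $m$ and covariance $\Sigma$.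
   Formalization: The claim that all non-singular solutions S are of this form is proved only when X_(p) has rank p; without this it is false, e.g. n = 2, p = 1, X = (1,0)^T, where every S is a solution but only S = -1/2 has the form. *)

theory Defs
  imports "HOL-Probability.Probability"
begin

text \<open>
  The rows of an \<open>n \<times> p\<close> matrix with \<open>p < n\<close> are indexed by \<open>'p + 'q\<close>, where
  \<open>CARD('p) = p\<close> and \<open>CARD('q) = n - p > 0\<close>: the indices \<^term>\<open>Inl i\<close> are the first \<open>p\<close>
  rows and the indices \<^term>\<open>Inr j\<close> the last \<open>n - p\<close> rows.  Since
  \<^typ>\<open>'a ^ 'p ^ 'n\<close> is a vector of rows, the following two functions apply to
  matrices as well as to column vectors.
\<close>

definition first_rows :: "'a ^ ('p::finite + 'q::finite) \<Rightarrow> 'a ^ 'p" where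
  "first_rows A = (\<chi> i. A $ Inl i)"

definition last_rows :: "'a ^ ('p::finite + 'q::finite) \<Rightarrow> 'a ^ 'q" where
  "last_rows A = (\<chi> j. A $ Inr j)"

definition orthonormal_columns :: "real ^ 'p ^ 'n \<Rightarrow> bool" where
  "orthonormal_columns Q \<longleftrightarrow> (\<forall>i j. column i Q \<bullet> column j Q = (if i = j then 1 else 0))"

text \<open>The parameter \<open>v\<close> is the variance; variance \<open>0\<close> gives the point mass at \<open>\<mu>\<close>.\<close>

definition univariate_normal :: "'w measure \<Rightarrow> ('w \<Rightarrow> real) \<Rightarrow> real \<Rightarrow> real \<Rightarrow> bool" where
  "univariate_normal M Z \<mu> v \<longleftrightarrow>
     (if v = 0 then Z \<in> borel_measurable M \<and> (AE \<omega> in M. Z \<omega> = \<mu>)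
      else v > 0 \<and> distributed M lborel Z (normal_density \<mu> (sqrt v)))"

text \<open>
  \<open>Z \<sim> N(m, \<Sigma>)\<close>, by the usual definition that also covers singular \<open>\<Sigma>\<close>: every linear
  combination \<open>a\<^sup>T Z\<close> is univariate normal, with mean \<open>a\<^sup>T m\<close> and variance
  \<open>a\<^sup>T \<Sigma> a\<close>.
\<close>

definition multivariate_normal ::
  "'w measure \<Rightarrow> ('w \<Rightarrow> real ^ 'n) \<Rightarrow> real ^ 'n \<Rightarrow> real ^ 'n ^ 'n \<Rightarrow> bool" where
  "multivariate_normal M Z m \<Sigma> \<longleftrightarrow>
     Z \<in> borel_measurable M \<and> transpose \<Sigma> = \<Sigma> \<and>
     (\<forall>a. univariate_normal M (\<lambda>\<omega>. a \<bullet> Z \<omega>) (a \<bullet> m) (a \<bullet> (\<Sigma> *v a)))"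

definition ols_estimate :: "real ^ 'p ^ 'n \<Rightarrow> real ^ 'n \<Rightarrow> real ^ 'p" where
  "ols_estimate X y = matrix_inv (transpose X ** X) *v (transpose X *v y)"

definition residuals :: "real ^ 'p ^ 'n \<Rightarrow> real ^ 'n \<Rightarrow> real ^ 'n" where
  "residuals X y = y - X *v ols_estimate X y"

definition transformed_residuals ::
  "real ^ 'p ^ ('p + 'q) \<Rightarrow> real ^ 'p ^ 'p \<Rightarrow> real ^ ('p::finite + 'q::finite) \<Rightarrow> real ^ 'q" where
  "transformed_residuals X S y =
     last_rows (residuals X y) + last_rows X *v (S *v first_rows (residuals X y))"

definition is_solution ::
  "'w measure \<Rightarrow> real ^ 'p ^ ('p + 'q) \<Rightarrow> ('w \<Rightarrow> real ^ ('p::finite + 'q::finite)) \<Rightarrow> real \<Rightarrow>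
     real ^ 'p ^ 'p \<Rightarrow> bool" where
  "is_solution M X Y \<sigma> S \<longleftrightarrow>
     multivariate_normal M (\<lambda>\<omega>. transformed_residuals X S (Y \<omega>)) 0 (\<sigma>\<^sup>2 *\<^sub>R mat 1) \<and>
     (AE \<omega> in M. transformed_residuals X S (Y \<omega>) \<bullet> transformed_residuals X S (Y \<omega>)
                  = residuals X (Y \<omega>) \<bullet> residuals X (Y \<omega>))"

end

theory Submission
  imports Defs
begin

text \<open>
  Since the residual maker \<open>N = I - X (X\<^sup>T X)\<^sup>-\<^sup>1 X\<^sup>T\<close> annihilates \<open>X\<close>, the vector \<open>W\<close> is the
  image of \<open>Y - X \<beta>\<close> under \<open>T N\<close>, where \<open>T\<close> has the blocks \<open>X\<^sub>2 S\<close> and \<open>I\<close> and \<open>X\<^sub>2\<close> denotes the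
  last rows of \<open>X\<close>.  Hence \<open>W\<close> has the required distribution iff \<open>T N T\<^sup>T = I\<close>.  For
  non-singular \<open>S\<close> put \<open>C = S\<^sup>-\<^sup>1 + X\<^sub>1\<close>, with \<open>X\<^sub>1\<close> the first rows of \<open>X\<close>.  Then \<open>T X = X\<^sub>2 S C\<close>, and so
  \<open>T N T\<^sup>T = I + X\<^sub>2 S (I - C (X\<^sup>T X)\<^sup>-\<^sup>1 C\<^sup>T) (X\<^sub>2 S)\<^sup>T\<close>.
  When \<open>X\<^sub>2\<close> is injective this is \<open>I\<close> iff \<open>C\<^sup>T C = X\<^sup>T X\<close>, i.e.\ iff \<open>X C\<^sup>-\<^sup>1\<close> has orthonormal
  columns.  The norm identity then follows from the normal equations \<open>X\<^sup>T R = 0\<close>.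
\<close>

section \<open>Matrix algebra: inverses, symmetric matrices and Gram matrices\<close>

lemma matrix_add_rdistrib: "(A + B) ** C = A ** C + B ** (C :: 'a::semiring_1 ^ _ ^ _)"
  by (simp add: vec_eq_iff matrix_matrix_mult_def sum.distrib distrib_right)

lemma matrix_diff_ldistrib: "A ** (B - C) = A ** B - A ** (C :: 'a::ring_1 ^ _ ^ _)"
  by (simp add: vec_eq_iff matrix_matrix_mult_def sum_subtractf right_diff_distrib)

lemma matrix_diff_rdistrib: "(A - B) ** C = A ** C - B ** (C :: 'a::ring_1 ^ _ ^ _)"
  by (simp add: vec_eq_iff matrix_matrix_mult_def sum_subtractf left_diff_distrib)

lemma transpose_add: "transpose (A + B) = transpose A + transpose B"
  by (simp add: vec_eq_iff transpose_def)

lemma transpose_diff: "transpose (A - B) = transpose A - transpose B"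
  by (simp add: vec_eq_iff transpose_def)

lemma inner_transpose_mult:
  fixes A :: "real ^ 'n ^ 'm"
  shows "x \<bullet> (A *v y) = (transpose A *v x) \<bullet> y"
  by (simp add: dot_lmul_matrix)

lemma matrix_inv_mult:
  assumes "invertible A"
  shows "A ** matrix_inv A = mat 1" "matrix_inv A ** A = mat 1"
  using someI_ex[OF assms[unfolded invertible_def]] by (simp_all add: matrix_inv_def)

lemma matrix_inv_unique:
  assumes "A ** B = mat 1" "B ** A = mat 1"
  shows "matrix_inv A = B"
proof -
  have "invertible A"
    using assms by (auto simp: invertible_def)
  then have "matrix_inv A ** (A ** B) = B"
    by (simp add: matrix_mul_assoc matrix_inv_mult)
  then show ?thesis
    using assms by simp
qed

lemma symmetric_matrix_inv:
  fixes A :: "real ^ 'n ^ 'n"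
  assumes "invertible A" "transpose A = A"
  shows "transpose (matrix_inv A) = matrix_inv A"
proof (rule matrix_inv_unique[symmetric])
  show "A ** transpose (matrix_inv A) = mat 1"
    using arg_cong[OF matrix_inv_mult(2)[OF assms(1)], of transpose] assms(2)
    by (simp add: matrix_transpose_mul)
  show "transpose (matrix_inv A) ** A = mat 1"
    using arg_cong[OF matrix_inv_mult(1)[OF assms(1)], of transpose] assms(2)
    by (simp add: matrix_transpose_mul)
qed

text \<open>Polarization.\<close>

lemma symmetric_matrix_eqI:
  fixes A B :: "real ^ 'n ^ 'n"
  assumes sym: "transpose A = A" "transpose B = B"
    and quad: "\<And>x. x \<bullet> (A *v x) = x \<bullet> (B *v x)"
  shows "A = B"
proof -
  have swap: "y \<bullet> (K *v x) = x \<bullet> (K *v y)" if "transpose K = K" for K :: "real ^ 'n ^ 'n" and x y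
    using inner_transpose_mult[of y K x] that by (simp add: inner_commute)
  have "x \<bullet> (A *v y) = x \<bullet> (B *v y)" for x y
    using quad[of "x + y"] quad[of x] quad[of y] swap[OF sym(1), of y x] swap[OF sym(2), of y x]
    by (simp add: matrix_vector_right_distrib inner_add_left inner_add_right)
  then have "A *v y = B *v y" for y
    by (metis vector_eq_ldot)
  then show ?thesis
    by (simp add: matrix_eq)
qed

text \<open>The quadratic form of the Gram matrix at \<open>x\<close> is the squared norm of
  \<open>X *v x\<close>, so its kernel is that of \<open>X\<close>, which is trivial by full
  rank.\<close>

lemma invertible_gram:
  fixes X :: "real ^ 'p ^ 'n"
  assumes "rank X = CARD('p)"
  shows "invertible (transpose X ** X)"
proof -
  have "x = 0" if "(transpose X ** X) *v x = 0" for x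
  proof -
    have "(X *v x) \<bullet> (X *v x) = x \<bullet> ((transpose X ** X) *v x)"
      by (metis inner_transpose_mult matrix_vector_mul_assoc inner_commute)
    then have "X *v x = 0"
      using that by simp
    moreover have "inj ((*v) X)"
      using assms full_rank_injective by blast
    ultimately show "x = 0"
      by (metis injD matrix_vector_mult_0_right)
  qed
  then show ?thesis
    by (simp add: invertible_left_inverse matrix_left_invertible_ker)
qed

lemma orthonormal_columns_iff: "orthonormal_columns Q \<longleftrightarrow> transpose Q ** Q = mat 1"
  by (simp add: orthonormal_columns_def vec_eq_iff matrix_matrix_mult_def transpose_def mat_def
      column_def inner_vec_def)

text \<open>Frees the condition from the inverse: the Gram matrix of
  \<open>X ** matrix_inv C\<close> is a congruence of that of \<open>X\<close>, undone by
  multiplying with \<open>transpose C\<close> on the left and \<open>C\<close> on the right.\<close>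

lemma orthonormal_columns_matrix_inv_iff:
  fixes X :: "real ^ 'p ^ 'n" and C :: "real ^ 'p ^ 'p"
  assumes "invertible C"
  shows "orthonormal_columns (X ** matrix_inv C) \<longleftrightarrow> transpose C ** C = transpose X ** X"
proof -
  let ?I = "matrix_inv C"
  have inv: "C ** ?I = mat 1" "?I ** C = mat 1"
    using matrix_inv_mult assms by auto
  then have invT: "transpose ?I ** transpose C = mat 1" "transpose C ** transpose ?I = mat 1"
    by (metis matrix_transpose_mul transpose_mat)+
  have Q: "transpose (X ** ?I) ** (X ** ?I) = transpose ?I ** (transpose X ** X) ** ?I"
    by (simp add: matrix_transpose_mul matrix_mul_assoc)
  show ?thesis
  proof
    assume "orthonormal_columns (X ** ?I)"
    then have "transpose C ** (transpose ?I ** (transpose X ** X) ** ?I) ** C = transpose C ** C"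
      by (simp add: orthonormal_columns_iff Q)
    moreover have "transpose C ** (transpose ?I ** (transpose X ** X) ** ?I) ** C
        = (transpose C ** transpose ?I) ** (transpose X ** X) ** (?I ** C)"
      by (simp add: matrix_mul_assoc)
    ultimately show "transpose C ** C = transpose X ** X"
      by (simp add: inv invT)
  next
    assume "transpose C ** C = transpose X ** X"
    then have "transpose ?I ** (transpose X ** X) ** ?I
        = (transpose ?I ** transpose C) ** (C ** ?I)"
      by (metis matrix_mul_assoc)
    then show "orthonormal_columns (X ** ?I)"
      by (simp add: orthonormal_columns_iff Q inv invT)
  qed
qed

subsection \<open>Normal distributions\<close>

lemma (in prob_space) univariate_normal_variance:
  assumes "univariate_normal M Z \<mu> v"
  shows "variance Z = v"
proof (cases "v = 0")
  case True
  then have Z: "Z \<in> borel_measurable M" "AE \<omega> in M. Z \<omega> = \<mu>"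
    using assms by (auto simp: univariate_normal_def)
  then have "expectation Z = expectation (\<lambda>_. \<mu>)"
    by (intro integral_cong_AE) auto
  then have "expectation Z = \<mu>"
    by (simp add: prob_space)
  then have "variance Z = expectation (\<lambda>_. 0)"
    using Z by (intro integral_cong_AE) auto
  with True show ?thesis
    by simp
next
  case False
  then have "v > 0" "distributed M lborel Z (normal_density \<mu> (sqrt v))"
    using assms by (auto simp: univariate_normal_def)
  then show ?thesis
    using normal_distributed_variance[of "sqrt v" Z \<mu>] by simp
qed

text \<open>The variances of all combinations \<open>a \<bullet> Z \<omega>\<close> fix the
  quadratic form of the covariance, and this form fixes a symmetric matrix.\<close>

lemma (in prob_space) multivariate_normal_covariance_unique:
  assumes "multivariate_normal M Z m \<Sigma>" "multivariate_normal M Z m' \<Sigma>'"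
  shows "\<Sigma> = \<Sigma>'"
proof (rule symmetric_matrix_eqI)
  fix a
  show "a \<bullet> (\<Sigma> *v a) = a \<bullet> (\<Sigma>' *v a)"
    using assms univariate_normal_variance unfolding multivariate_normal_def by metis
qed (use assms in \<open>auto simp: multivariate_normal_def\<close>)

lemma multivariate_normal_linear_image:
  fixes A :: "real ^ 'n ^ 'm"
  assumes "multivariate_normal M Z m \<Sigma>"
  shows "multivariate_normal M (\<lambda>\<omega>. A *v Z \<omega>) (A *v m) (A ** \<Sigma> ** transpose A)"
  unfolding multivariate_normal_def
proof (intro conjI allI)
  have "Z \<in> borel_measurable M"
    using assms by (simp add: multivariate_normal_def)
  then show "(\<lambda>\<omega>. A *v Z \<omega>) \<in> borel_measurable M"
    by (rule borel_measurable_continuous_on[rotated])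
      (simp add: linear_continuous_on linear_linear)
  show "transpose (A ** \<Sigma> ** transpose A) = A ** \<Sigma> ** transpose A"
    using assms by (simp add: multivariate_normal_def matrix_transpose_mul matrix_mul_assoc)
  fix a
  have "univariate_normal M (\<lambda>\<omega>. (transpose A *v a) \<bullet> Z \<omega>) ((transpose A *v a) \<bullet> m)
      ((transpose A *v a) \<bullet> (\<Sigma> *v (transpose A *v a)))"
    using assms unfolding multivariate_normal_def by blast
  then show "univariate_normal M (\<lambda>\<omega>. a \<bullet> (A *v Z \<omega>)) (a \<bullet> (A *v m))
      (a \<bullet> ((A ** \<Sigma> ** transpose A) *v a))"
    unfolding inner_transpose_mult[symmetric] matrix_vector_mul_assoc matrix_mul_assoc .
qed

subsection \<open>Residuals and their transformation\<close>

lemma first_rows_mult: "first_rows (A ** B) = first_rows A ** B"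
  by (simp add: first_rows_def matrix_matrix_mult_def)

lemma last_rows_mult: "last_rows (A ** B) = last_rows A ** B"
  by (simp add: last_rows_def matrix_matrix_mult_def)

lemma first_rows_mult_vec: "first_rows (A *v x) = first_rows A *v x"
  by (simp add: first_rows_def matrix_vector_mult_def)

lemma last_rows_mult_vec: "last_rows (A *v x) = last_rows A *v x"
  by (simp add: last_rows_def matrix_vector_mult_def)

lemma sum_UNIV_Plus:
  "(\<Sum>k\<in>(UNIV :: ('p::finite + 'q::finite) set). f k) = (\<Sum>i\<in>UNIV. f (Inl i)) + (\<Sum>j\<in>UNIV. f (Inr j))"
  by (simp add: UNIV_Plus_UNIV[symmetric] sum.Plus del: UNIV_Plus_UNIV)

lemma inner_rows_split:
  fixes x y :: "real ^ ('p::finite + 'q::finite)"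
  shows "x \<bullet> y = first_rows x \<bullet> first_rows y + last_rows x \<bullet> last_rows y"
  by (simp add: inner_vec_def first_rows_def last_rows_def sum_UNIV_Plus)

text \<open>For \<open>X\<close> of full column rank, the orthogonal projection onto the complement
  of its column space.\<close>

definition residual_maker :: "real ^ 'p ^ 'n \<Rightarrow> real ^ 'n ^ 'n" where
  "residual_maker X = mat 1 - X ** matrix_inv (transpose X ** X) ** transpose X"

text \<open>The row blocks of the identity are coordinate selections; with them the block matrix is
  an ordinary sum of products.\<close>

definition residual_transform ::
  "real ^ 'p ^ ('p + 'q) \<Rightarrow> real ^ 'p ^ 'p \<Rightarrow> real ^ ('p::finite + 'q::finite) ^ 'q" where
  "residual_transform X S = last_rows (mat 1) + last_rows X ** S ** first_rows (mat 1)"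

lemma residuals_eq: "residuals X y = residual_maker X *v y"
  unfolding residuals_def ols_estimate_def residual_maker_def matrix_vector_mult_diff_rdistrib
    matrix_vector_mul_assoc matrix_vector_mul_lid matrix_mul_assoc ..

lemma transformed_residuals_eq:
  fixes X :: "real ^ 'p ^ ('p::finite + 'q::finite)"
  shows "transformed_residuals X S y = residual_transform X S *v residuals X y"
proof -
  have "first_rows (mat 1) *v r = first_rows r" "last_rows (mat 1) *v r = last_rows r"
    for r :: "real ^ ('p + 'q)"
    by (simp_all flip: first_rows_mult_vec last_rows_mult_vec)
  then show ?thesis
    by (simp add: transformed_residuals_def residual_transform_def matrix_vector_mult_add_rdistrib
        flip: matrix_vector_mul_assoc)
qed

context
  fixes X :: "real ^ 'p ^ 'n"
  assumes rank: "rank X = CARD('p)"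
begin

lemma residual_maker_mult_design: "residual_maker X ** X = 0"
  using matrix_inv_mult(2)[OF invertible_gram[OF rank]]
  by (simp add: residual_maker_def matrix_diff_rdistrib flip: matrix_mul_assoc)

lemma symmetric_residual_maker: "transpose (residual_maker X) = residual_maker X"
  using symmetric_matrix_inv[OF invertible_gram[OF rank]]
  by (simp add: residual_maker_def transpose_diff matrix_transpose_mul matrix_mul_assoc)

lemma residual_maker_idem: "residual_maker X ** residual_maker X = residual_maker X"
proof -
  have "residual_maker X ** residual_maker X
      = residual_maker X - residual_maker X ** X ** matrix_inv (transpose X ** X) ** transpose X"
    \<comment> \<open>Only the right factor is unfolded, so that the left one meets \<open>X\<close>
      and annihilates it.\<close>
    by (subst (2) residual_maker_def) (simp add: matrix_diff_ldistrib matrix_mul_assoc)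
  then show ?thesis
    by (simp add: residual_maker_mult_design)
qed

text \<open>The unknown \<beta> drops out, so the centred vector can replace
  \<open>Y\<close>.\<close>

lemma residuals_diff_design: "residuals X (y - X *v b) = residuals X y"
  by (simp add: residuals_eq matrix_vector_mult_diff_distrib matrix_vector_mul_assoc
      residual_maker_mult_design)

text \<open>The normal equations: the residual maker is symmetric and annihilates
  \<open>X\<close>.\<close>

lemma residuals_orthogonal: "residuals X y \<bullet> (X *v x) = 0"
proof -
  have "residuals X y \<bullet> (X *v x) = y \<bullet> (residual_maker X *v (X *v x))"
    by (metis residuals_eq inner_transpose_mult symmetric_residual_maker)
  then show ?thesis
    by (simp add: matrix_vector_mul_assoc residual_maker_mult_design)
qed

end

section \<open>Covariance, norm and distribution of the transformed residuals\<close>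

lemma residual_transform_covariance:
  fixes X :: "real ^ 'p ^ ('p::finite + 'q::finite)"
  assumes inv: "S ** (C - first_rows X) = mat 1"
  shows "residual_transform X S ** residual_maker X ** transpose (residual_transform X S)
    = mat 1 + (last_rows X ** S) **
        (mat 1 - C ** matrix_inv (transpose X ** X) ** transpose C) ** transpose (last_rows X ** S)"
proof -
  define E :: "real ^ ('p + 'q) ^ 'p" where "E = first_rows (mat 1)"
  define F :: "real ^ ('p + 'q) ^ 'q" where "F = last_rows (mat 1)"
  define U where "U = last_rows X ** S"
  define G where "G = matrix_inv (transpose X ** X)"
  define T where "T = residual_transform X S"
  have T: "T = F + U ** E"
    by (simp add: T_def residual_transform_def E_def F_def U_def)
  have EF: "E ** transpose E = mat 1" "E ** transpose F = 0" "F ** transpose E = 0"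
      "F ** transpose F = mat 1"
    by (simp_all add: E_def F_def flip: first_rows_mult last_rows_mult)
      (simp_all add: vec_eq_iff first_rows_def last_rows_def transpose_def mat_def)
  have "T ** transpose T = F ** transpose F + U ** (E ** transpose F)
      + (F ** transpose E) ** transpose U + U ** (E ** transpose E) ** transpose U"
    by (simp add: T transpose_add matrix_transpose_mul matrix_add_ldistrib matrix_add_rdistrib
        matrix_mul_assoc)
  then have TT: "T ** transpose T = mat 1 + U ** transpose U"
    by (simp add: EF)
  have "E ** X = first_rows X" "F ** X = last_rows X"
    by (simp_all add: E_def F_def flip: first_rows_mult last_rows_mult)
  \<comment> \<open>Here \<open>C\<close> enters: adding \<open>U ** first_rows X\<close> to this
    leaves just \<open>U ** C\<close>.\<close>
  moreover have "last_rows X = U ** (C - first_rows X)"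
    using inv by (simp add: U_def flip: matrix_mul_assoc)
  ultimately have TX: "T ** X = U ** C"
    by (simp add: T matrix_add_rdistrib matrix_diff_ldistrib flip: matrix_mul_assoc)
  have "T ** residual_maker X ** transpose T
      = T ** transpose T - (T ** X) ** G ** transpose (T ** X)"
    by (simp add: residual_maker_def G_def matrix_diff_ldistrib matrix_diff_rdistrib
        matrix_transpose_mul matrix_mul_assoc)
  also have "\<dots> = mat 1 + U ** (mat 1 - C ** G ** transpose C) ** transpose U"
    by (simp add: TT TX matrix_diff_ldistrib matrix_diff_rdistrib matrix_transpose_mul
        matrix_mul_assoc)
  finally show ?thesis
    by (simp add: T_def U_def G_def)
qed

lemma transformed_residuals_norm:
  fixes X :: "real ^ 'p ^ ('p::finite + 'q::finite)"
  assumes rank: "rank X = CARD('p)"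
    and inv: "(C - first_rows X) ** S = mat 1"
    and C: "transpose C ** C = transpose X ** X"
  shows "transformed_residuals X S y \<bullet> transformed_residuals X S y
    = residuals X y \<bullet> residuals X y"
proof -
  define r where "r = residuals X y"
  define r1 where "r1 = first_rows r"
  define r2 where "r2 = last_rows r"
  define s where "s = S *v r1"
  let ?a = "first_rows X *v s" and ?b = "last_rows X *v s"
  have "r \<bullet> (X *v s) = 0"
    using residuals_orthogonal[OF rank] by (simp add: r_def)
  then have orth: "r1 \<bullet> ?a + r2 \<bullet> ?b = 0"
    by (simp add: inner_rows_split[of r] r1_def r2_def first_rows_mult_vec last_rows_mult_vec)
  have "(C - first_rows X) *v s = r1"
    using inv by (simp add: s_def matrix_vector_mul_assoc)
  then have Cs: "C *v s = r1 + ?a"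
    by (simp add: matrix_vector_mult_diff_rdistrib algebra_simps)
  \<comment> \<open>Equal Gram matrices mean that \<open>C\<close> and \<open>X\<close> give every
    vector the same norm.\<close>
  have "(C *v s) \<bullet> (C *v s) = (X *v s) \<bullet> (X *v s)"
    by (metis C inner_transpose_mult matrix_vector_mul_assoc)
  then have "(r1 + ?a) \<bullet> (r1 + ?a) = ?a \<bullet> ?a + ?b \<bullet> ?b"
    by (simp add: Cs inner_rows_split[of "X *v s"] first_rows_mult_vec last_rows_mult_vec)
  \<comment> \<open>The terms \<open>?a \<bullet> ?a\<close> cancel, and \<open>orth\<close> trades
    the cross term of the first rows for that of the last rows.\<close>
  with orth have "(r2 + ?b) \<bullet> (r2 + ?b) = r1 \<bullet> r1 + r2 \<bullet> r2"
    by (simp add: inner_add_left inner_add_right inner_commute)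
  moreover have "transformed_residuals X S y = r2 + ?b"
    by (simp add: transformed_residuals_def r_def r1_def r2_def s_def)
  moreover have "residuals X y \<bullet> residuals X y = r1 \<bullet> r1 + r2 \<bullet> r2"
    by (simp add: inner_rows_split[of r] r1_def r2_def flip: r_def)
  ultimately show ?thesis
    by simp
qed

text \<open>\<open>W\<close> is a linear image of the centred vector, and the residual maker is a
  symmetric idempotent, so the covariance is \<sigma> squared times the left-hand matrix. Uniqueness
  of the covariance gives the forward direction.\<close>

lemma transformed_residuals_normal_iff:
  fixes X :: "real ^ 'p ^ ('p::finite + 'q::finite)"
  assumes "prob_space M" and rank: "rank X = CARD('p)" and \<sigma>: "\<sigma>\<^sup>2 > 0"
    and Y: "multivariate_normal M (\<lambda>\<omega>. Y \<omega> - X *v \<beta>) 0 (\<sigma>\<^sup>2 *\<^sub>R mat 1)"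
  shows "multivariate_normal M (\<lambda>\<omega>. transformed_residuals X S (Y \<omega>)) 0 (\<sigma>\<^sup>2 *\<^sub>R mat 1) \<longleftrightarrow>
    residual_transform X S ** residual_maker X ** transpose (residual_transform X S) = mat 1"
proof -
  interpret prob_space M by fact
  let ?T = "residual_transform X S" and ?N = "residual_maker X"
  let ?K = "?T ** ?N ** transpose ?T"
  have W: "transformed_residuals X S (Y \<omega>) = (?T ** ?N) *v (Y \<omega> - X *v \<beta>)" for \<omega>
    by (metis transformed_residuals_eq residuals_diff_design[OF rank] residuals_eq
        matrix_vector_mul_assoc)
  have "(?T ** ?N) ** (\<sigma>\<^sup>2 *\<^sub>R mat 1) ** transpose (?T ** ?N)
      = \<sigma>\<^sup>2 *\<^sub>R (?T ** (?N ** ?N) ** transpose ?T)"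
    by (simp add: matrix_scalar_ac scalar_matrix_assoc matrix_transpose_mul matrix_mul_assoc
        symmetric_residual_maker[OF rank])
  then have K: "multivariate_normal M (\<lambda>\<omega>. transformed_residuals X S (Y \<omega>)) 0 (\<sigma>\<^sup>2 *\<^sub>R ?K)"
    using multivariate_normal_linear_image[OF Y, of "?T ** ?N"]
    by (simp add: W residual_maker_idem[OF rank])
  show ?thesis
  proof
    assume "multivariate_normal M (\<lambda>\<omega>. transformed_residuals X S (Y \<omega>)) 0 (\<sigma>\<^sup>2 *\<^sub>R mat 1)"
    then have "\<sigma>\<^sup>2 *\<^sub>R ?K = \<sigma>\<^sup>2 *\<^sub>R mat 1"
      using K multivariate_normal_covariance_unique by blast
    with \<sigma> show "?K = mat 1"
      by simp
  next
    assume "?K = mat 1"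
    with K show "multivariate_normal M (\<lambda>\<omega>. transformed_residuals X S (Y \<omega>)) 0 (\<sigma>\<^sup>2 *\<^sub>R mat 1)"
      by simp
  qed
qed

text \<open>The rank condition on \<open>last_rows X\<close> guards the converse: if
  \<open>last_rows X = 0\<close>, then the first residuals vanish and every \<open>S\<close> is a
  solution, whatever the Gram matrix of \<open>matrix_inv S + first_rows X\<close>.\<close>

theorem theorem7:
  fixes M :: "'w measure"
    and X :: "real ^ 'p ^ ('p::finite + 'q::finite)"
    and \<beta> :: "real ^ 'p" and \<sigma> :: real
    and Y :: "'w \<Rightarrow> real ^ ('p + 'q)"
  assumes "prob_space M"
    and "rank X = CARD('p)"
    and "\<sigma>\<^sup>2 > 0"
    and "multivariate_normal M (\<lambda>\<omega>. Y \<omega> - X *v \<beta>) 0 (\<sigma>\<^sup>2 *\<^sub>R mat 1)"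
  shows "(\<forall>C :: real ^ 'p ^ 'p.
            invertible C \<and> orthonormal_columns (X ** matrix_inv C) \<and> invertible (C - first_rows X)
            \<longrightarrow> is_solution M X Y \<sigma> (matrix_inv (C - first_rows X)))
       \<and> (rank (last_rows X) = CARD('p) \<longrightarrow>
          (\<forall>S :: real ^ 'p ^ 'p. invertible S \<and> is_solution M X Y \<sigma> S \<longrightarrow>
             (\<exists>C :: real ^ 'p ^ 'p.
                invertible C \<and> orthonormal_columns (X ** matrix_inv C) \<and>
                invertible (C - first_rows X) \<and> S = matrix_inv (C - first_rows X))))"
proof -
  let ?G = "transpose X ** X"
  have G: "invertible ?G"
    using invertible_gram assms(2) .
  note normal_iff = transformed_residuals_normal_iff[OF assms]
  have "is_solution M X Y \<sigma> (matrix_inv (C - first_rows X))"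
    if C: "invertible C" and orth: "orthonormal_columns (X ** matrix_inv C)"
      and D: "invertible (C - first_rows X)"
    for C :: "real ^ 'p ^ 'p"
  proof -
    have CC: "transpose C ** C = ?G"
      using orthonormal_columns_matrix_inv_iff C orth by blast
    \<comment> \<open>For square matrices a right inverse is a left inverse; the swap makes the
      correction term of the covariance vanish.\<close>
    then have "transpose C ** (C ** matrix_inv ?G) = mat 1"
      using matrix_inv_mult(1)[OF G] by (simp add: matrix_mul_assoc)
    then have "C ** matrix_inv ?G ** transpose C = mat 1"
      using matrix_left_right_inverse by blast
    with residual_transform_covariance[OF matrix_inv_mult(2)[OF D]]
    show ?thesis
      by (simp add: is_solution_def normal_iff
          transformed_residuals_norm[OF assms(2) matrix_inv_mult(1)[OF D] CC])
  qed
  moreover have "\<exists>C. invertible C \<and> orthonormal_columns (X ** matrix_inv C) \<and>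
      invertible (C - first_rows X) \<and> S = matrix_inv (C - first_rows X)"
    if rank: "rank (last_rows X) = CARD('p)" and S: "invertible S"
      and sol: "is_solution M X Y \<sigma> S"
    for S :: "real ^ 'p ^ 'p"
  proof -
    \<comment> \<open>The only candidate, obtained by solving
      \<open>S = matrix_inv (C - first_rows X)\<close> for \<open>C\<close>.\<close>
    define C where "C = matrix_inv S + first_rows X"
    let ?U = "last_rows X ** S" and ?Z = "mat 1 - C ** matrix_inv ?G ** transpose C"
    have inv: "S ** (C - first_rows X) = mat 1" "(C - first_rows X) ** S = mat 1"
      using matrix_inv_mult[OF S] by (simp_all add: C_def)
    have "?U ** ?Z ** transpose ?U = 0"
      using sol residual_transform_covariance[OF inv(1)] by (simp add: is_solution_def normal_iff)
    \<comment> \<open>Full column rank yields a left inverse of \<open>last_rows X\<close>, hence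
      one of \<open>?U\<close>, which cancels \<open>?U\<close> on both sides of
      \<open>?Z\<close>.\<close>
    moreover obtain B where "B ** last_rows X = mat 1"
      using rank by (auto simp: full_rank_injective matrix_left_invertible_injective[symmetric])
    then have L: "(matrix_inv S ** B) ** ?U = mat 1"
      by (metis S matrix_inv_mult(2) matrix_mul_assoc matrix_mul_lid)
    moreover have "?Z = ((matrix_inv S ** B) ** ?U) ** ?Z **
        transpose ((matrix_inv S ** B) ** ?U)"
      by (simp add: L)
    then have "?Z = (matrix_inv S ** B) ** (?U ** ?Z ** transpose ?U) **
        transpose (matrix_inv S ** B)"
      unfolding matrix_transpose_mul matrix_mul_assoc .
    ultimately have "?Z = 0"
      by simp
    \<comment> \<open>\<open>?Z = 0\<close> exhibits an inverse of \<open>C\<close>, so its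
      invertibility comes for free.\<close>
    then have "C ** (matrix_inv ?G ** transpose C) = mat 1"
      by (simp add: matrix_mul_assoc)
    moreover from this have left: "matrix_inv ?G ** transpose C ** C = mat 1"
      using matrix_left_right_inverse by blast
    ultimately have C: "invertible C"
      by (auto simp: invertible_def)
    have "transpose C ** C = ?G ** (matrix_inv ?G ** transpose C ** C)"
      by (simp add: matrix_mul_assoc matrix_inv_mult(1)[OF G])
    then have "transpose C ** C = ?G"
      by (simp add: left)
    then have "orthonormal_columns (X ** matrix_inv C)"
      using orthonormal_columns_matrix_inv_iff C by blast
    moreover have "invertible (C - first_rows X)" "S = matrix_inv (C - first_rows X)"
      using inv matrix_inv_unique by (auto simp: invertible_def)
    ultimately show ?thesis
      using C by blast
  qed
  ultimately show ?thesis
    by blast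
qed

end
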